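(* Let $n\ge2$, $M\ge1$ and let $\mathcal D=\{d_1,\ldots,d_M\}\subset\mathbb S^{n-1}$. The following are equivalent: (1) $\mathcal D$ is robustly trace-free sensing; (2) $\operatorname{span}\{d_j\otimes d_j:1\le j\le M\}=\operatorname{Sym}(n)$; (3) the map $B\mapsto(d_j^\top Bd_j)_{j=1}^M$ is injective on $\operatorname{Sym}(n)$. Consequently every robustly trace-free sensing system satisfies $M\ge N_n:=\frac{n(n+1)}2$, and this lower bound is attained by some system.
   Context: $\operatorname{Sym}(n)$ is the space of real symmetric $n\times n$ matrices and $\operatorname{Sym}_0(n)=\{B\in\operatorname{Sym}(n):\operatorname{tr}B=0\}$. $\mathbb S^{n-1}$ is the unit sphere in $\mathbb R^n$ and $d\otimes d=dd^\top$. For $F\in\mathrm{SL}(n,\mathbb R)$ put $\tau_j(F)=Fd_j/|Fd_j|$. The system $\mathcal D$ is called robustly trace-free sensing if, for every $F\in\mathrm{SL}(n,\mathbb R)$, the map $B\mapsto(\tau_j(F)^\top B\,\tau_j(F))_{j=1}^M$ is injective on $\operatorname{Sym}_0(n)$. *)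

theory Defs
  imports "HOL-Analysis.Analysis"
begin

definition Sym :: "(real ^ 'n ^ 'n) set" where
  "Sym = {B. transpose B = B}"

definition Sym0 :: "(real ^ 'n ^ 'n) set" where
  "Sym0 = {B \<in> Sym. trace B = 0}"

definition SL :: "(real ^ 'n ^ 'n) set" where
  "SL = {F. det F = 1}"

definition tensor_sq :: "real ^ 'n \<Rightarrow> real ^ 'n ^ 'n" where
  "tensor_sq v = (\<chi> i j. v $ i * v $ j)"

text \<open>
  A system of \<open>M\<close> unit vectors in Euclidean space is a family indexed by \<open>{1..M}\<close>; the values of
  \<open>d\<close> at other indices are irrelevant. Repetitions are allowed, and \<open>M\<close> counts indices.
\<close>

definition unit_system :: "nat \<Rightarrow> (nat \<Rightarrow> real ^ 'n) \<Rightarrow> bool" where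
  "unit_system M d \<longleftrightarrow> 1 \<le> M \<and> (\<forall>j\<in>{1..M}. d j \<in> sphere 0 1)"

text \<open>
  The map taking \<open>B\<close> to the tuple of the \<open>v\<^sub>j\<^sup>T B v\<^sub>j\<close>, \<open>1 \<le> j \<le> M\<close>. A tuple is a function
  restricted to \<open>{1..M}\<close>, so that equality of tuples is equality of the \<open>M\<close> entries.
\<close>

definition measurement_map ::
    "nat \<Rightarrow> (nat \<Rightarrow> real ^ 'n) \<Rightarrow> real ^ 'n ^ 'n \<Rightarrow> nat \<Rightarrow> real" where
  "measurement_map M v B = (\<lambda>j\<in>{1..M}. v j \<bullet> (B *v v j))"

definition deformed_dir ::
    "(nat \<Rightarrow> real ^ 'n) \<Rightarrow> real ^ 'n ^ 'n \<Rightarrow> nat \<Rightarrow> real ^ 'n" where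
  "deformed_dir d F j = (F *v d j) /\<^sub>R norm (F *v d j)"

definition robustly_trace_free_sensing :: "nat \<Rightarrow> (nat \<Rightarrow> real ^ 'n) \<Rightarrow> bool" where
  "robustly_trace_free_sensing M d \<longleftrightarrow>
     (\<forall>F\<in>SL. inj_on (measurement_map M (deformed_dir d F)) Sym0)"

end

theory Submission
  imports Defs
begin

text \<open>
  Since \<open>d\<^sup>T B d\<close> is the inner product of \<open>B\<close> with \<open>d \<otimes> d\<close>, spanning and injectivity on \<open>Sym\<close>
  are equivalent by orthogonal complements, and a congruence \<open>B \<mapsto> F\<^sup>T B F\<close> carries injectivity
  on \<open>Sym\<close> to every deformed system.

  For the converse let \<open>B \<in> Sym\<close> be invisible to the system. If \<open>B\<close> takes a value of the opposite
  sign to its trace at a unit vector \<open>u\<close>, then a stretch \<open>G\<close> along \<open>u\<close> makes \<open>G\<^sup>T B G\<close>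
  trace free, and it is invisible to the system deformed by \<open>G\<^sup>-\<^sup>1\<close> (rescaled to determinant 1).
  Otherwise \<open>B\<close> is semidefinite, so every \<open>d\<^sub>j\<close> lies in its kernel; if \<open>B \<noteq> 0\<close>, the \<open>d\<^sub>j\<close> lie in
  a hyperplane \<open>a\<^sup>\<bottom>\<close>, and the symmetrized product of \<open>a\<close> with some \<open>w \<bottom> a\<close> is trace free and
  invisible to the undeformed system.
\<close>

section \<open>Symmetric matrices: spanning and injectivity by duality\<close>

lemma subspace_Sym: "subspace (Sym :: (real ^ 'n::finite ^ 'n) set)"
  by (auto simp: subspace_def Sym_def transpose_def vec_eq_iff)

lemma subspace_Sym0: "subspace (Sym0 :: (real ^ 'n::finite ^ 'n) set)"
  using subspace_Sym
  by (auto simp: subspace_def Sym0_def trace_def sum.distrib simp flip: sum_distrib_left)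

lemma tensor_sq_in_Sym: "tensor_sq v \<in> Sym"
  by (simp add: Sym_def transpose_def tensor_sq_def vec_eq_iff mult.commute)

lemma inner_tensor_sq: "tensor_sq v \<bullet> B = v \<bullet> (B *v v)"
  by (simp add: inner_vec_def tensor_sq_def matrix_vector_mult_def sum_distrib_left mult_ac)

lemma symmetric_form_commute:
  "B \<in> Sym \<Longrightarrow> v \<bullet> (B *v w) = w \<bullet> (B *v v)"
  by (metis (mono_tags) Sym_def dot_lmul_matrix inner_commute mem_Collect_eq
      vector_transpose_matrix)

text \<open>A proper subspace of \<open>Sym\<close> has a nonzero orthogonal vector inside
  \<open>Sym\<close>; conversely, a vector of the span that is orthogonal to \<open>S\<close> is
  orthogonal to itself.\<close>

lemma span_eq_Sym_iff:
  fixes S :: "(real ^ 'n::finite ^ 'n) set"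
  assumes "S \<subseteq> Sym"
  shows "span S = Sym \<longleftrightarrow> (\<forall>B\<in>Sym. (\<forall>x\<in>S. x \<bullet> B = 0) \<longrightarrow> B = 0)"
proof
  assume S: "span S = Sym"
  show "\<forall>B\<in>Sym. (\<forall>x\<in>S. x \<bullet> B = 0) \<longrightarrow> B = 0"
  proof (intro ballI impI)
    fix B assume "B \<in> Sym" "\<forall>x\<in>S. x \<bullet> B = 0"
    then have "orthogonal B B"
      using S orthogonal_to_span[of B S B] by (simp add: orthogonal_def inner_commute)
    then show "B = 0" by (simp add: orthogonal_def)
  qed
next
  assume R: "\<forall>B\<in>Sym. (\<forall>x\<in>S. x \<bullet> B = 0) \<longrightarrow> B = 0"
  show "span S = Sym"
  proof (rule ccontr)
    assume "span S \<noteq> Sym"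
    moreover have "span S \<subseteq> Sym"
      using assms subspace_Sym by (rule span_minimal)
    ultimately have "span S \<subset> span Sym"
      by (simp add: psubset_eq span_eq_iff[THEN iffD2, OF subspace_Sym])
    then obtain B where "B \<noteq> 0" "B \<in> span Sym" "\<And>y. y \<in> span S \<Longrightarrow> orthogonal B y"
      using orthogonal_to_subspace_exists_gen by blast
    then show False
      using R by (auto simp: span_eq_iff[THEN iffD2, OF subspace_Sym] orthogonal_def
          inner_commute span_base)
  qed
qed

lemma inj_on_measurement_map_iff:
  assumes "subspace V"
  shows "inj_on (measurement_map M v) V \<longleftrightarrow>
    (\<forall>B\<in>V. (\<forall>j\<in>{1..M}. v j \<bullet> (B *v v j) = 0) \<longrightarrow> B = 0)"
proof -
  have eq: "measurement_map M v A = measurement_map M v B \<longleftrightarrow>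
      (\<forall>j\<in>{1..M}. v j \<bullet> ((A - B) *v v j) = 0)" for A B
    by (auto simp: measurement_map_def restrict_def fun_eq_iff matrix_vector_mult_diff_rdistrib
        inner_diff_right)
  show ?thesis
  proof
    assume L: "inj_on (measurement_map M v) V"
    show "\<forall>B\<in>V. (\<forall>j\<in>{1..M}. v j \<bullet> (B *v v j) = 0) \<longrightarrow> B = 0"
      using inj_onD[OF L, of _ 0] eq[of _ 0] subspace_0[OF assms] by auto
  next
    assume R: "\<forall>B\<in>V. (\<forall>j\<in>{1..M}. v j \<bullet> (B *v v j) = 0) \<longrightarrow> B = 0"
    show "inj_on (measurement_map M v) V"
      using R eq subspace_diff[OF assms] by (intro inj_onI) (metis eq_iff_diff_eq_0)
  qed
qed

lemma span_tensor_sq_iff_inj_on: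
  fixes d :: "nat \<Rightarrow> real ^ 'n::finite"
  shows "span {tensor_sq (d j) | j. j \<in> {1..M}} = Sym \<longleftrightarrow> inj_on (measurement_map M d) Sym"
proof -
  have "{tensor_sq (d j) | j. j \<in> {1..M}} \<subseteq> Sym"
    using tensor_sq_in_Sym by auto
  moreover have "(\<forall>x\<in>{tensor_sq (d j) | j. j \<in> {1..M}}. x \<bullet> B = 0) \<longleftrightarrow>
      (\<forall>j\<in>{1..M}. d j \<bullet> (B *v d j) = 0)" for B
    by (auto simp: setcompr_eq_image inner_tensor_sq)
  ultimately show ?thesis
    by (simp add: span_eq_Sym_iff inj_on_measurement_map_iff[OF subspace_Sym])
qed

subsection \<open>Congruence\<close>

lemma congruence_form:
  fixes B F :: "real ^ 'n::finite ^ 'n"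
  shows "v \<bullet> ((transpose F ** B ** F) *v v) = (F *v v) \<bullet> (B *v (F *v v))"
  by (metis dot_lmul_matrix matrix_vector_mul_assoc vector_transpose_matrix)

lemma congruence_in_Sym: "B \<in> Sym \<Longrightarrow> transpose F ** B ** F \<in> Sym"
  by (simp add: Sym_def matrix_transpose_mul matrix_mul_assoc)

lemma deformed_dir_form:
  "deformed_dir d F j \<bullet> (B *v deformed_dir d F j) =
    (F *v d j) \<bullet> (B *v (F *v d j)) / (norm (F *v d j))\<^sup>2"
  by (simp add: deformed_dir_def matrix_vector_mult_scaleR power2_eq_square divide_inverse)

text \<open>Normalizing \<open>F *v d j\<close> only divides the form by a squared norm, which keeps
  its zeros; if \<open>F *v d j = 0\<close>, both expressions vanish.\<close>

lemma robustly_trace_free_sensing_iff: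
  fixes d :: "nat \<Rightarrow> real ^ 'n::finite"
  shows "robustly_trace_free_sensing M d \<longleftrightarrow>
    (\<forall>F\<in>SL. \<forall>B\<in>Sym0. (\<forall>j\<in>{1..M}. (F *v d j) \<bullet> (B *v (F *v d j)) = 0) \<longrightarrow> B = 0)"
  by (simp add: robustly_trace_free_sensing_def inj_on_measurement_map_iff[OF subspace_Sym0]
      deformed_dir_form) (metis inner_zero_left)

lemma inj_on_Sym_imp_robust:
  fixes d :: "nat \<Rightarrow> real ^ 'n::finite"
  assumes "inj_on (measurement_map M d) Sym"
  shows "robustly_trace_free_sensing M d"
  unfolding robustly_trace_free_sensing_iff
proof (intro ballI impI)
  fix F B :: "real ^ 'n ^ 'n"
  assume F: "F \<in> SL" and B: "B \<in> Sym0"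
    and z: "\<forall>j\<in>{1..M}. (F *v d j) \<bullet> (B *v (F *v d j)) = 0"
  \<comment> \<open>The congruent matrix is symmetric but in general not trace free, hence the
    appeal to injectivity on all of \<open>Sym\<close>.\<close>
  have "transpose F ** B ** F = 0"
    using assms B z
    by (simp add: inj_on_measurement_map_iff[OF subspace_Sym] congruence_form
        congruence_in_Sym Sym0_def)
  moreover have "invertible F"
    using F by (simp add: SL_def invertible_det_nz)
  then obtain G where G: "F ** G = mat 1"
    using invertible_right_inverse by blast
  then have "transpose G ** transpose F = mat 1"
    by (metis matrix_transpose_mul transpose_mat)
  then have "transpose G ** (transpose F ** B ** F) ** G = B"
    using G by (metis matrix_mul_assoc matrix_mul_lid matrix_mul_rid)
  ultimately show "B = 0"
    by simp
qed

subsection \<open>Stretches along a line\<close>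

text \<open>For a unit vector \<open>u\<close>, this scales by \<open>r\<close> along
  \<open>u\<close> and fixes its orthogonal complement.\<close>

definition stretch :: "real ^ 'n \<Rightarrow> real \<Rightarrow> real ^ 'n ^ 'n" where
  "stretch u r = mat 1 + (r - 1) *\<^sub>R tensor_sq u"

lemma tensor_sq_mult_vec: "tensor_sq u *v v = (u \<bullet> v) *\<^sub>R u"
  by (simp add: tensor_sq_def matrix_vector_mult_def inner_vec_def vec_eq_iff sum_distrib_left
      sum_distrib_right mult_ac)

lemma stretch_mult_vec: "stretch u r *v v = v + ((r - 1) * (u \<bullet> v)) *\<^sub>R u"
  by (simp add: stretch_def matrix_vector_mult_add_rdistrib tensor_sq_mult_vec
      flip: scaleR_matrix_vector_assoc)

lemma stretch_mult:
  assumes "norm u = 1"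
  shows "stretch u r ** stretch u s = stretch u (r * s)"
proof -
  have "u \<bullet> u = 1" using assms by (simp add: norm_eq_1)
  then show ?thesis
    by (simp add: matrix_eq stretch_mult_vec inner_add_right algebra_simps
        flip: matrix_vector_mul_assoc)
qed

lemma stretch_1: "stretch u 1 = mat 1"
  by (simp add: stretch_def)

lemma transpose_stretch: "transpose (stretch u r) = stretch u r"
  by (auto simp: stretch_def transpose_def tensor_sq_def mat_def vec_eq_iff mult.commute)

text \<open>Factoring through \<open>sqrt r\<close> makes the determinant a square, and the inverse
  stretch makes it nonzero.\<close>

lemma det_stretch_pos:
  fixes u :: "real ^ 'n::finite"
  assumes "norm u = 1" "r > 0"
  shows "det (stretch u r) > 0"
proof -
  have "stretch u r = stretch u (sqrt r) ** stretch u (sqrt r)"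
    using assms by (simp add: stretch_mult)
  moreover have "stretch u r ** stretch u (inverse r) = mat 1"
    using assms by (simp add: stretch_mult stretch_1)
  then have "det (stretch u r) \<noteq> 0"
    by (metis det_I det_mul mult_zero_left zero_neq_one)
  ultimately show ?thesis
    by (metis det_mul not_square_less_zero linorder_neqE_linordered_idom)
qed

text \<open>Cyclicity of the trace merges both stretches into one by \<open>r\<^sup>2\<close>, which
  is the identity plus a multiple of \<open>tensor_sq u\<close>.\<close>

lemma trace_stretch_congruence:
  assumes "norm u = 1"
  shows "trace (stretch u r ** B ** stretch u r) = trace B + (r\<^sup>2 - 1) * (u \<bullet> (B *v u))"
proof -
  have tens: "trace (tensor_sq u ** B) = u \<bullet> (B *v u)"
    by (simp add: trace_def matrix_matrix_mult_def tensor_sq_def inner_vec_def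
        matrix_vector_mult_def sum_distrib_left mult_ac) (subst sum.swap, simp add: mult_ac)
  have "trace (stretch u r ** B ** stretch u r) = trace (stretch u r ** (stretch u r ** B))"
    by (rule trace_mul_sym)
  also have "\<dots> = trace (stretch u (r\<^sup>2) ** B)"
    by (simp add: matrix_mul_assoc stretch_mult[OF assms] power2_eq_square)
  also have "stretch u (r\<^sup>2) ** B = B + (r\<^sup>2 - 1) *\<^sub>R (tensor_sq u ** B)"
    by (simp add: stretch_def matrix_eq matrix_vector_mult_add_rdistrib
        flip: matrix_vector_mul_assoc scaleR_matrix_vector_assoc)
  finally show ?thesis
    by (simp add: trace_add tens[symmetric]) (simp add: trace_def sum_distrib_left)
qed

lemma robust_imp_form_nonpos:
  fixes d :: "nat \<Rightarrow> real ^ 'n::finite"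
  assumes rob: "robustly_trace_free_sensing M d" and B: "B \<in> Sym"
    and z: "\<forall>j\<in>{1..M}. d j \<bullet> (B *v d j) = 0" and tr: "trace B < 0"
  shows "v \<bullet> (B *v v) \<le> 0"
proof (rule ccontr)
  assume v: "\<not> v \<bullet> (B *v v) \<le> 0"
  then have "v \<noteq> 0" by auto
  define u where "u = v /\<^sub>R norm v"
  have u: "norm u = 1" using \<open>v \<noteq> 0\<close> by (simp add: u_def)
  define b where "b = u \<bullet> (B *v u)"
  have b: "b > 0"
    using v \<open>v \<noteq> 0\<close> by (simp add: b_def u_def matrix_vector_mult_scaleR)
  \<comment> \<open>Solves \<open>trace B + (t\<^sup>2 - 1) * b = 0\<close>; the radicand exceeds 1
    because \<open>trace B < 0 < b\<close>.\<close>
  define t where "t = sqrt (1 - trace B / b)"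
  have t: "t > 0" "t\<^sup>2 = 1 - trace B / b"
    using b tr by (auto simp: t_def divide_less_0_iff less_imp_le add_pos_pos diff_gt_0_iff_gt
        intro!: less_trans[of _ 0])
  define C where "C = stretch u t ** B ** stretch u t"
  have "C \<in> Sym"
    using congruence_in_Sym[OF B, of "stretch u t"] by (simp add: C_def transpose_stretch)
  moreover have "trace C = 0"
    using b by (simp add: C_def trace_stretch_congruence[OF u] t flip: b_def)
  ultimately have C: "C \<in> Sym0" by (simp add: Sym0_def)
  define E where "E = stretch u (inverse t)"
  have inv: "stretch u t ** E = mat 1" "E ** stretch u t = mat 1"
    using t by (simp_all add: E_def stretch_mult[OF u] stretch_1)
  have ECE: "E ** C ** E = B"
    using inv unfolding C_def by (metis matrix_mul_assoc matrix_mul_lid matrix_mul_rid)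
  have E: "det E > 0"
    using t u by (simp add: E_def det_stretch_pos)
  \<comment> \<open>Scaling by \<open>c\<close> multiplies the determinant by
    \<open>c ^ CARD('n)\<close>, so this root normalizes it to 1; a quadratic form keeps its zeros
    under scaling.\<close>
  define c where "c = inverse (root CARD('n) (det E))"
  have "c ^ CARD('n) * det E = 1"
    using E by (simp add: c_def power_inverse)
  then have "mat c ** E \<in> SL"
    by (simp add: SL_def det_mul flip: matrix_scaleR)
  moreover have "((mat c ** E) *v d j) \<bullet> (C *v ((mat c ** E) *v d j)) = 0" if "j \<in> {1..M}" for j
  proof -
    have "(E *v d j) \<bullet> (C *v (E *v d j)) = d j \<bullet> ((E ** C ** E) *v d j)"
      using congruence_form[of "d j" E C] by (simp add: E_def transpose_stretch)
    then have "(E *v d j) \<bullet> (C *v (E *v d j)) = 0"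
      using z that by (simp add: ECE)
    moreover have "mat c *v x = c *\<^sub>R x" for x :: "real ^ 'n"
      by (simp add: vec_eq_iff matrix_vector_mult_def mat_def if_distribR if_distrib cong: if_cong)
    ultimately show ?thesis
      by (simp add: matrix_vector_mult_scaleR flip: matrix_vector_mul_assoc)
  qed
  ultimately have "C = 0"
    using rob C by (simp add: robustly_trace_free_sensing_iff)
  then have "B = 0" using ECE \<open>C = 0\<close> by simp
  then show False using tr by (simp add: trace_def)
qed

subsection \<open>Robust sensing implies injectivity\<close>

text \<open>A zero \<open>x\<close> of a nonnegative form is a minimum, so the gradient there, twice
  \<open>B *v x\<close>, vanishes.\<close>

lemma nonneg_form_kernel:
  fixes B :: "real ^ 'n::finite ^ 'n"
  assumes B: "B \<in> Sym" and nn: "\<And>v. 0 \<le> v \<bullet> (B *v v)" and z: "x \<bullet> (B *v x) = 0"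
  shows "B *v x = 0"
proof (rule ccontr)
  assume "B *v x \<noteq> 0"
  define w where "w = B *v x"
  define q where "q = w \<bullet> (B *v w)"
  define p where "p = w \<bullet> w"
  have p: "p > 0" using \<open>B *v x \<noteq> 0\<close> by (simp add: p_def w_def)
  have q: "q \<ge> 0" using nn by (simp add: q_def)
  \<comment> \<open>Moving from \<open>x\<close> against \<open>w\<close> would make the form negative.\<close>
  have expand: "(x - s *\<^sub>R w) \<bullet> (B *v (x - s *\<^sub>R w)) = s\<^sup>2 * q - 2 * s * p" for s
    using z symmetric_form_commute[OF B, of x w]
    by (simp add: matrix_vector_mult_diff_distrib matrix_vector_mult_scaleR inner_diff_left
        inner_diff_right p_def q_def power2_eq_square algebra_simps flip: w_def)
  \<comment> \<open>With \<open>p = s * (q + 1)\<close> the expansion becomes visibly negative; the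
    \<open>+ 1\<close> covers \<open>q = 0\<close>.\<close>
  define s where "s = p / (q + 1)"
  have s: "s > 0" "s * (q + 1) = p" using p q by (simp_all add: s_def)
  have "s\<^sup>2 * q - 2 * s * p = - (s\<^sup>2 * q + 2 * s\<^sup>2)"
    by (simp add: power2_eq_square algebra_simps flip: s(2))
  also have "\<dots> < 0"
  proof -
    have "0 \<le> s\<^sup>2 * q" "0 < s\<^sup>2" using s q by simp_all
    then show ?thesis by linarith
  qed
  finally show False using nn[of "x - s *\<^sub>R w"] expand[of s] by simp
qed

lemma robust_imp_not_in_hyperplane:
  fixes d :: "nat \<Rightarrow> real ^ 'n::finite"
  assumes rob: "robustly_trace_free_sensing M d" and n: "CARD('n) \<ge> 2"
    and perp: "\<forall>j\<in>{1..M}. a \<bullet> d j = 0"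
  shows "a = 0"
proof (rule ccontr)
  assume "a \<noteq> 0"
  \<comment> \<open>\<open>CARD('n) \<ge> 2\<close> leaves room for a nonzero vector orthogonal to
    \<open>a\<close>.\<close>
  have "dim {a} < DIM(real ^ 'n)"
    using dim_le_card[of "{a}" "{a}"] n by (simp add: span_superset)
  then obtain w where w: "w \<noteq> 0" "orthogonal w a"
    using orthogonal_to_subspace_exists[of "{a}"] by (metis span_base singletonI)
  \<comment> \<open>The form of \<open>C\<close> at \<open>v\<close> is twice the product of
    \<open>a \<bullet> v\<close> and \<open>w \<bullet> v\<close>, so it vanishes on the hyperplane;
    yet \<open>C *v w\<close> is a nonzero multiple of \<open>a\<close>.\<close>
  define C where "C = (\<chi> i j. a $ i * w $ j + w $ i * a $ j)"
  have C: "C *v v = (w \<bullet> v) *\<^sub>R a + (a \<bullet> v) *\<^sub>R w" for v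
    by (simp add: C_def vec_eq_iff matrix_vector_mult_def inner_vec_def sum.distrib sum_distrib_left
        sum_distrib_right algebra_simps)
  have "trace C = 2 * (a \<bullet> w)"
    by (simp add: C_def trace_def inner_vec_def sum.distrib sum_distrib_left mult.commute)
  then have "C \<in> Sym0"
    using w by (auto simp: Sym0_def Sym_def orthogonal_def inner_commute C_def transpose_def
        vec_eq_iff mult.commute add.commute)
  moreover have "d j \<bullet> (C *v d j) = 0" if "j \<in> {1..M}" for j
    using perp that by (simp add: C inner_add_right inner_commute)
  moreover have "mat 1 \<in> (SL :: (real ^ 'n ^ 'n) set)" by (simp add: SL_def)
  ultimately have "C = 0"
    using rob unfolding robustly_trace_free_sensing_iff by (metis matrix_vector_mul_lid)
  then have "(w \<bullet> w) *\<^sub>R a = 0"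
    using C[of w] w by (simp add: orthogonal_def inner_commute)
  then show False using w \<open>a \<noteq> 0\<close> by simp
qed

text \<open>\<open>B\<close> is symmetric and kills each \<open>d j\<close>, so every
  \<open>B *v v\<close> is orthogonal to the whole system and can serve as the normal
  \<open>a\<close> of the previous lemma.\<close>

lemma robust_nonneg_kernel:
  fixes d :: "nat \<Rightarrow> real ^ 'n::finite"
  assumes rob: "robustly_trace_free_sensing M d" and n: "CARD('n) \<ge> 2"
    and B: "B \<in> Sym" and z: "\<forall>j\<in>{1..M}. d j \<bullet> (B *v d j) = 0"
    and nn: "\<And>v. 0 \<le> v \<bullet> (B *v v)"
  shows "B = 0"
proof -
  have "B *v v = 0" for v
  proof (rule robust_imp_not_in_hyperplane[OF rob n], intro ballI)
    fix j assume "j \<in> {1..M}"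
    then have "B *v d j = 0" using nonneg_form_kernel[OF B nn] z by blast
    then show "(B *v v) \<bullet> d j = 0"
      using symmetric_form_commute[OF B, of "d j" v] by (simp add: inner_commute)
  qed
  then show ?thesis by (simp add: matrix_eq)
qed

lemma uminus_matrix_vector_mult:
  fixes B :: "real ^ 'n ^ 'm"
  shows "- B *v v = - (B *v v)"
  by (simp add: matrix_vector_mult_def vec_eq_iff sum_negf)

lemma robust_imp_inj_on_Sym:
  fixes d :: "nat \<Rightarrow> real ^ 'n::finite"
  assumes rob: "robustly_trace_free_sensing M d" and n: "CARD('n) \<ge> 2"
  shows "inj_on (measurement_map M d) Sym"
  unfolding inj_on_measurement_map_iff[OF subspace_Sym]
proof (intro ballI impI)
  \<comment> \<open>A negative trace makes the form of \<open>- B\<close> nonnegative by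
    \<open>robust_imp_form_nonpos\<close>; a positive trace is reduced to this case by a change of
    sign.\<close>
  have neg: "B = 0"
    if B: "B \<in> Sym" and z: "\<forall>j\<in>{1..M}. d j \<bullet> (B *v d j) = 0" and "trace B < 0" for B
  proof -
    have "- B = 0"
      using robust_imp_form_nonpos[OF rob that] z subspace_neg[OF subspace_Sym B]
      by (intro robust_nonneg_kernel[OF rob n]) (simp_all add: uminus_matrix_vector_mult)
    then show ?thesis by simp
  qed
  fix B :: "real ^ 'n ^ 'n"
  assume B: "B \<in> Sym" and z: "\<forall>j\<in>{1..M}. d j \<bullet> (B *v d j) = 0"
  consider "trace B < 0" | "trace B = 0" | "trace (- B) < 0"
    using linorder_less_linear[of "trace B" 0] by (auto simp: trace_def sum_negf)
  then show "B = 0"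
  proof cases
    case 1
    then show ?thesis using neg B z by blast
  next
    case 2
    \<comment> \<open>A trace-free \<open>B\<close> is already detected by the undeformed system,
      \<open>F = mat 1\<close>.\<close>
    have "mat 1 \<in> (SL :: (real ^ 'n ^ 'n) set)" by (simp add: SL_def)
    moreover have "B \<in> Sym0" using B 2 by (simp add: Sym0_def)
    ultimately show ?thesis
      using rob z unfolding robustly_trace_free_sensing_iff by (metis matrix_vector_mul_lid)
  next
    case 3
    have "- B = 0"
      using neg[of "- B"] 3 z subspace_neg[OF subspace_Sym B]
      by (simp add: uminus_matrix_vector_mult)
    then show ?thesis by simp
  qed
qed

subsection \<open>Dimension\<close>

text \<open>Indexing by the sets \<open>{i, j}\<close> avoids having to order the index type.\<close>

definition pair_matrix :: "'n set \<Rightarrow> real ^ 'n ^ 'n" where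
  "pair_matrix s = (\<chi> i j. if {i, j} = s then 1 else 0)"

lemma inner_pair_matrix:
  "pair_matrix s \<bullet> B = (\<Sum>i\<in>UNIV. \<Sum>j\<in>UNIV. if {i, j} = s then B $ i $ j else 0)"
  by (auto simp: pair_matrix_def inner_vec_def intro!: sum.cong)

text \<open>Pairing a symmetric \<open>B\<close> with \<open>pair_matrix {i, j}\<close> gives
  \<open>B $ i $ j\<close> times the number of ordered pairs with underlying set
  \<open>{i, j}\<close>, which is positive.\<close>

lemma span_pair_matrices:
  "span (pair_matrix ` {{i, j} | i j. True}) = (Sym :: (real ^ 'n::finite ^ 'n) set)"
proof -
  have "pair_matrix s \<in> Sym" for s :: "'n set"
    by (simp add: Sym_def pair_matrix_def transpose_def vec_eq_iff insert_commute)
  moreover have "B = 0"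
    if B: "B \<in> Sym" and z: "\<forall>x\<in>pair_matrix ` {{i, j} | i j. True}. x \<bullet> B = 0"
    for B :: "real ^ 'n ^ 'n"
  proof -
    have "B $ i $ j = 0" for i j
    proof -
      have "B $ l $ k = B $ k $ l" for k l
        using B by (auto simp: Sym_def transpose_def vec_eq_iff)
      then have "pair_matrix {i, j} \<bullet> B =
          (\<Sum>k\<in>UNIV. \<Sum>l\<in>UNIV. (if {k, l} = {i, j} then 1 else 0) * B $ i $ j)"
        unfolding inner_pair_matrix
        by (intro sum.cong refl) (auto simp: doubleton_eq_iff)
      also have "\<dots> = (\<Sum>k\<in>UNIV. \<Sum>l\<in>UNIV. (if {k, l} = {i, j} then 1 else 0)) * B $ i $ j"
        by (simp add: sum_distrib_right)
      finally have "(\<Sum>k\<in>UNIV. \<Sum>l\<in>UNIV. (if {k, l} = {i, j} then 1 else 0)) * B $ i $ j =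
          pair_matrix {i, j} \<bullet> B" by (rule sym)
      also have "\<dots> = 0"
        using z by auto
      finally have "(\<Sum>k\<in>UNIV. \<Sum>l\<in>UNIV. (if {k, l} = {i, j} then 1 else 0)) * B $ i $ j = 0" .
      moreover have "0 < (\<Sum>l\<in>UNIV. (if {i, l} = {i, j} then 1 else 0 :: real))"
        by (rule sum_pos2[where i = j]) auto
      then have "0 < (\<Sum>k\<in>UNIV. \<Sum>l\<in>UNIV. (if {k, l} = {i, j} then 1 else 0 :: real))"
        by (rule sum_pos2[where i = i, rotated 2]) (auto intro: sum_nonneg)
      ultimately show ?thesis by (metis mult_eq_0_iff less_irrefl)
    qed
    then show "B = 0" by (simp add: vec_eq_iff)
  qed
  ultimately show ?thesis
    by (subst span_eq_Sym_iff) auto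
qed

text \<open>With \<open>i = j\<close> allowed, these sets are the singletons and the two-element
  sets.\<close>

lemma card_pairs: "card {{i, j} | i j :: 'n::finite. True} = CARD('n) * (CARD('n) + 1) div 2"
proof -
  have "{{i, j} | i j :: 'n. True} = {s. s \<subseteq> UNIV \<and> card s = 1} \<union> {s. s \<subseteq> UNIV \<and> card s = 2}"
    by (auto simp: card_1_singleton_iff card_2_iff)
  moreover have "card ({s :: 'n set. s \<subseteq> UNIV \<and> card s = 1} \<union> {s. s \<subseteq> UNIV \<and> card s = 2}) =
      (CARD('n) choose 1) + (CARD('n) choose 2)"
    by (subst card_Un_disjoint) (auto simp: n_subsets[of UNIV, simplified])
  moreover have "m + m * (m - 1) div 2 = m * (m + 1) div 2" for m :: nat
    by (cases m) (auto simp: algebra_simps)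
  ultimately show ?thesis by (simp add: choose_two)
qed

text \<open>Distinct pair matrices have disjoint supports, so they form an orthogonal basis.\<close>

lemma dim_Sym: "dim (Sym :: (real ^ 'n::finite ^ 'n) set) = CARD('n) * (CARD('n) + 1) div 2"
proof -
  define P where "P = {{i, j} | i j :: 'n. True}"
  have self: "pair_matrix s \<bullet> pair_matrix s > 0" if "s \<in> P" for s
    using that by (auto simp: P_def pair_matrix_def vec_eq_iff)
  have orth: "pair_matrix s \<bullet> pair_matrix t = 0" if "s \<noteq> t" for s t :: "'n set"
    unfolding inner_pair_matrix using that
    by (intro sum.neutral ballI) (auto simp: pair_matrix_def)
  have "inj_on pair_matrix P"
    using self orth by (metis inj_onI less_irrefl)
  then have "card (pair_matrix ` P) = card P"
    by (rule card_image)
  moreover have "independent (pair_matrix ` P)"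
  proof (rule pairwise_orthogonal_independent)
    show "pairwise orthogonal (pair_matrix ` P)"
      unfolding pairwise_def orthogonal_def using orth by (metis imageE)
    show "0 \<notin> pair_matrix ` P"
      using self by force
  qed
  ultimately have "dim (span (pair_matrix ` P)) = card P"
    by (simp add: dim_eq_card_independent)
  then show ?thesis
    unfolding P_def span_pair_matrices card_pairs .
qed

text \<open>By homogeneity, a symmetric \<open>B\<close> orthogonal to all these squares has zero
  quadratic form; \<open>nonneg_form_kernel\<close> then takes the place of polarization.\<close>

lemma span_tensor_sq_sphere:
  "span (tensor_sq ` sphere 0 1) = (Sym :: (real ^ 'n::finite ^ 'n) set)"
proof -
  have "B = 0" if B: "B \<in> Sym" and z: "\<forall>x\<in>tensor_sq ` sphere 0 1. x \<bullet> B = 0"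
    for B :: "real ^ 'n ^ 'n"
  proof -
    have q: "v \<bullet> (B *v v) = 0" for v
    proof (cases "v = 0")
      case False
      then have "(v /\<^sub>R norm v) \<bullet> (B *v (v /\<^sub>R norm v)) = 0"
        using z by (auto simp flip: inner_tensor_sq)
      then show ?thesis using False by (simp add: matrix_vector_mult_scaleR)
    qed simp
    then have "B *v v = 0" for v
      by (intro nonneg_form_kernel[OF B]) simp_all
    then show ?thesis by (simp add: matrix_eq)
  qed
  then show ?thesis
    using tensor_sq_in_Sym by (subst span_eq_Sym_iff) auto
qed

text \<open>Coinciding squares only shrink the spanning set, so \<open>M\<close> still bounds its
  cardinality.\<close>

lemma span_tensor_sq_imp_le:
  fixes d :: "nat \<Rightarrow> real ^ 'n::finite"
  assumes "span {tensor_sq (d j) | j. j \<in> {1..M}} = Sym"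
  shows "CARD('n) * (CARD('n) + 1) div 2 \<le> M"
proof -
  have eq: "{tensor_sq (d j) | j. j \<in> {1..M}} = (\<lambda>j. tensor_sq (d j)) ` {1..M}" by auto
  have "dim (Sym :: (real ^ 'n ^ 'n) set) \<le> card ((\<lambda>j. tensor_sq (d j)) ` {1..M})"
    using assms unfolding eq by (intro dim_le_card) auto
  also have "\<dots> \<le> M" using card_image_le[of "{1..M}"] by simp
  finally show ?thesis by (simp add: dim_Sym)
qed

text \<open>The squares of all unit vectors span, so they contain a basis, whose size is the
  dimension of \<open>Sym\<close>.\<close>

lemma exists_minimal_spanning_system:
  "\<exists>d :: nat \<Rightarrow> real ^ 'n::finite. unit_system (CARD('n) * (CARD('n) + 1) div 2) d \<and>
    span {tensor_sq (d j) | j. j \<in> {1..CARD('n) * (CARD('n) + 1) div 2}} = Sym"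
proof -
  define N where "N = CARD('n) * (CARD('n) + 1) div 2"
  obtain S where S: "S \<subseteq> tensor_sq ` sphere (0 :: real ^ 'n) 1" "independent S"
    "tensor_sq ` sphere 0 1 \<subseteq> span S" "card S = dim (tensor_sq ` sphere (0 :: real ^ 'n) 1)"
    by (rule basis_exists)
  have span: "span S = Sym"
    using S span_tensor_sq_sphere by (metis span_mono span_minimal subspace_span subset_antisym)
  have "card S = N"
    using S(4) dim_span[of "tensor_sq ` sphere (0 :: real ^ 'n) 1"]
    by (simp add: span_tensor_sq_sphere dim_Sym N_def del: dim_span)
  moreover have "finite S"
    using S(2) independent_imp_finite by blast
  ultimately obtain g where g: "bij_betw g {1..N} S"
    using ex_bij_betw_nat_finite_1 by blast
  \<comment> \<open>\<open>v\<close> and \<open>- v\<close> have the same square, so a preimage has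
    to be chosen.\<close>
  define d where "d j = (SOME v. v \<in> sphere 0 1 \<and> tensor_sq v = g j)" for j
  have d: "d j \<in> sphere 0 1 \<and> tensor_sq (d j) = g j" if "j \<in> {1..N}" for j
  proof -
    have "g j \<in> tensor_sq ` sphere 0 1" using g S(1) that bij_betwE by blast
    then have "\<exists>v. v \<in> sphere 0 1 \<and> tensor_sq v = g j" by auto
    then show ?thesis unfolding d_def by (rule someI_ex)
  qed
  have "{tensor_sq (d j) | j. j \<in> {1..N}} = g ` {1..N}"
    using d by force
  also have "\<dots> = S" using g by (simp add: bij_betw_def)
  finally have "span {tensor_sq (d j) | j. j \<in> {1..N}} = Sym" by (simp add: span)
  moreover have "1 \<le> N"
    using mult_le_mono[of 1 "CARD('n)" 2 "CARD('n) + 1"] by (simp add: N_def)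
  then have "unit_system N d"
    using d by (simp add: unit_system_def)
  ultimately show ?thesis unfolding N_def by blast
qed

theorem theoremB:
  assumes "CARD('n::finite) \<ge> 2"
  shows
    "(\<forall>M (d :: nat \<Rightarrow> real ^ 'n). unit_system M d \<longrightarrow>
        (robustly_trace_free_sensing M d \<longleftrightarrow> span {tensor_sq (d j) | j. j \<in> {1..M}} = Sym) \<and>
        (span {tensor_sq (d j) | j. j \<in> {1..M}} = Sym \<longleftrightarrow> inj_on (measurement_map M d) Sym)) \<and>
     (\<forall>M (d :: nat \<Rightarrow> real ^ 'n). unit_system M d \<and> robustly_trace_free_sensing M d \<longrightarrow>
        M \<ge> CARD('n) * (CARD('n) + 1) div 2) \<and>
     (\<exists>M (d :: nat \<Rightarrow> real ^ 'n). unit_system M d \<and> robustly_trace_free_sensing M d \<and>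
        M = CARD('n) * (CARD('n) + 1) div 2)"
proof -
  have robust: "robustly_trace_free_sensing M d \<longleftrightarrow>
      span {tensor_sq (d j) | j. j \<in> {1..M}} = Sym" for M and d :: "nat \<Rightarrow> real ^ 'n"
    using inj_on_Sym_imp_robust robust_imp_inj_on_Sym[OF _ assms] span_tensor_sq_iff_inj_on
    by blast
  then show ?thesis
    using span_tensor_sq_iff_inj_on span_tensor_sq_imp_le exists_minimal_spanning_system
    by blast
qed

end
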